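(* Let $\mu>0$, $s\in\mathbb{R}$, $c\in\mathbb{R}$, let $\Psi\in C^1([a,b])$ be an increasing positive function on $[a,b]\subset\mathbb{R}$ with $\Psi'(x)\neq0$ for all $x\in[a,b]$, and let $p\ge1$, $q\ge1$ with $\frac1p+\frac1q\le1+\mu$ (assuming $p\neq1$ and $q\neq1$ in the case when $\frac1p+\frac1q=1+\mu$). If $f\in X^{p}_{\Psi,c}(a,b)$ and $g\in X^{q}_{\Psi,c}(a,b)$, then $$\int_a^b\frac{\Psi'(x)}{\Psi(x)}f(x)\,{}^{H}_{a}I^{\mu,s}_{\Psi(x)}g(x)\,dx=\int_a^b\frac{\Psi'(x)}{\Psi(x)}g(x)\,{}^{H}_{\Psi(x)}I^{\mu,s}_{b}f(x)\,dx.$$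
   Context: For $c\in\mathbb{R}$ and $1\le p\le\infty$, $X^{p}_{\Psi,c}(a,b)$ is the space of all Lebesgue measurable $f:[a,b]\to\mathbb{C}$ with $\|f\|_{X^{p}_{\Psi,c}}<\infty$, where $$\|f\|_{X^{p}_{\Psi,c}}=\left(\int_a^b\left|\Psi(x)^{c}f(x)\right|^p\frac{\Psi'(x)}{\Psi(x)}\,dx\right)^{1/p}\ (1\le p<\infty),\qquad \|f\|_{X^{\infty}_{\Psi,c}}=\operatorname*{ess\,sup}_{a\le x\le b}\left(\Psi(x)^{c}|f(x)|\right).$$ The left-sided and right-sided Hadamard-type fractional integrals with respect to $\Psi$ of order $\mu>0$ and parameter $s$ are $${}^{H}_{a}I^{\mu,s}_{\Psi(x)}f(x)=\frac{1}{\Gamma(\mu)}\int_{a}^{x}\left(\frac{\Psi(t)}{\Psi(x)}\right)^{s}\left(\log\frac{\Psi(x)}{\Psi(t)}\right)^{\mu-1}f(t)\frac{\Psi'(t)}{\Psi(t)}\,dt,$$ $${}^{H}_{\Psi(x)}I^{\mu,s}_{b}f(x)=\frac{1}{\Gamma(\mu)}\int_{x}^{b}\left(\frac{\Psi(x)}{\Psi(t)}\right)^{s}\left(\log\frac{\Psi(t)}{\Psi(x)}\right)^{\mu-1}f(t)\frac{\Psi'(t)}{\Psi(t)}\,dt.$$ *)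

theory Defs
  imports "HOL-Analysis.Analysis" "HOL-Probability.Essential_Supremum"
begin

text \<open>The derivative of a function on [a,b] is taken within [a,b], i.e. it is one-sided at the
  endpoints.\<close>

definition deriv_on :: "real \<Rightarrow> real \<Rightarrow> (real \<Rightarrow> real) \<Rightarrow> real \<Rightarrow> real" where
  "deriv_on a b \<Psi> x = vector_derivative \<Psi> (at x within {a..b})"

definition C1_on :: "real \<Rightarrow> real \<Rightarrow> (real \<Rightarrow> real) \<Rightarrow> bool" where
  "C1_on a b \<Psi> \<longleftrightarrow> \<Psi> differentiable_on {a..b} \<and> continuous_on {a..b} (deriv_on a b \<Psi>)"

definition log_deriv_on :: "real \<Rightarrow> real \<Rightarrow> (real \<Rightarrow> real) \<Rightarrow> real \<Rightarrow> real" where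
  "log_deriv_on a b \<Psi> x = deriv_on a b \<Psi> x / \<Psi> x"

text \<open>The norm takes values in the extended nonnegative reals, and the exponent \<open>p\<close> ranges over
  [1,\<open>\<infinity>\<close>]. Since \<open>powr\<close> is not available on \<^typ>\<open>ennreal\<close>, the root of a divergent integral is
  set to \<open>\<infinity>\<close> explicitly.\<close>

definition X_norm ::
  "real \<Rightarrow> real \<Rightarrow> (real \<Rightarrow> real) \<Rightarrow> real \<Rightarrow> ennreal \<Rightarrow> (real \<Rightarrow> complex) \<Rightarrow> ennreal" where
  "X_norm a b \<Psi> c p f =
     (if p = \<infinity> then
        esssup (lebesgue_on {a..b}) (\<lambda>x. ennreal (\<Psi> x powr c * norm (f x)))
      else
        (let I = (\<integral>\<^sup>+ x. ennreal (norm (complex_of_real (\<Psi> x powr c) * f x) powr enn2real p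
                                   * log_deriv_on a b \<Psi> x) \<partial>lebesgue_on {a..b})
         in if I = \<infinity> then \<infinity> else ennreal (enn2real I powr (1 / enn2real p))))"

definition X_space ::
  "real \<Rightarrow> real \<Rightarrow> (real \<Rightarrow> real) \<Rightarrow> real \<Rightarrow> ennreal \<Rightarrow> (real \<Rightarrow> complex) set" where
  "X_space a b \<Psi> c p =
     {f. f \<in> borel_measurable (lebesgue_on {a..b}) \<and> X_norm a b \<Psi> c p f < \<infinity>}"

text \<open>The integrands are named separately so that convergence of the fractional integrals can be
  stated: the Lebesgue integral of a non-integrable function is 0 by convention.\<close>

definition hadamard_left_integrand ::
  "real \<Rightarrow> real \<Rightarrow> (real \<Rightarrow> real) \<Rightarrow> real \<Rightarrow> real \<Rightarrow> (real \<Rightarrow> complex) \<Rightarrow> real \<Rightarrow> real \<Rightarrow> complex" where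
  "hadamard_left_integrand a b \<Psi> \<mu> s f x t =
     complex_of_real ((\<Psi> t / \<Psi> x) powr s * ln (\<Psi> x / \<Psi> t) powr (\<mu> - 1)) * f t
       * complex_of_real (log_deriv_on a b \<Psi> t)"

definition hadamard_right_integrand ::
  "real \<Rightarrow> real \<Rightarrow> (real \<Rightarrow> real) \<Rightarrow> real \<Rightarrow> real \<Rightarrow> (real \<Rightarrow> complex) \<Rightarrow> real \<Rightarrow> real \<Rightarrow> complex" where
  "hadamard_right_integrand a b \<Psi> \<mu> s f x t =
     complex_of_real ((\<Psi> x / \<Psi> t) powr s * ln (\<Psi> t / \<Psi> x) powr (\<mu> - 1)) * f t
       * complex_of_real (log_deriv_on a b \<Psi> t)"

definition hadamard_left ::
  "real \<Rightarrow> real \<Rightarrow> (real \<Rightarrow> real) \<Rightarrow> real \<Rightarrow> real \<Rightarrow> (real \<Rightarrow> complex) \<Rightarrow> real \<Rightarrow> complex" where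
  "hadamard_left a b \<Psi> \<mu> s f x =
     complex_of_real (1 / Gamma \<mu>)
       * (LINT t|lebesgue_on {a..x}. hadamard_left_integrand a b \<Psi> \<mu> s f x t)"

definition hadamard_right ::
  "real \<Rightarrow> real \<Rightarrow> (real \<Rightarrow> real) \<Rightarrow> real \<Rightarrow> real \<Rightarrow> (real \<Rightarrow> complex) \<Rightarrow> real \<Rightarrow> complex" where
  "hadamard_right a b \<Psi> \<mu> s f x =
     complex_of_real (1 / Gamma \<mu>)
       * (LINT t|lebesgue_on {x..b}. hadamard_right_integrand a b \<Psi> \<mu> s f x t)"

end

theory Submission
  imports Defs
begin

text \<open>
  Both sides are iterated integrals of one function
  \<open>\<Phi>(x, t) = k(x, t) * f x * g t\<close> over the square, where \<open>k\<close> lives on the triangle \<open>t \<le> x\<close> and contains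
  the two weights \<open>\<Psi>'/\<Psi>\<close>. The theorem is therefore Fubini's theorem, and the work is to show that
  \<open>\<Phi>\<close> is absolutely integrable.

  As \<open>ln \<circ> \<Psi>\<close> has a derivative bounded between two positive constants, \<open>ln (\<Psi> x / \<Psi> t)\<close> is comparable
  to \<open>x - t\<close>, and \<open>\<bar>k(x, t)\<bar>\<close> is at most a constant times \<open>\<bar>x - t\<bar> powr (-\<kappa>)\<close> with \<open>\<kappa> = 1 - \<mu>\<close>
  (\<open>hadamard_kernel_bound\<close>). The weights in the norms are bounded below, so
  \<open>\<bar>f\<bar> \<le> A * F powr \<alpha>\<close> and \<open>\<bar>g\<bar> \<le> B * G powr \<beta>\<close> for integrable \<open>F, G \<ge> 1\<close>, with \<open>\<alpha> = 1/p\<close> and \<open>\<beta> = 1/q\<close>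
  (\<open>X_space_majorant\<close>). What remains is the finiteness of the double integral of
  \<open>F x powr \<alpha> * G t powr \<beta> * \<bar>x - t\<bar> powr (-\<kappa>)\<close> for \<open>\<alpha> + \<beta> + \<kappa> \<le> 2\<close>, with \<open>\<alpha>, \<beta> < 1\<close> in case
  of equality (\<open>riesz_potential_finite\<close>): this is Young's convolution inequality below the critical sum, and the
  Hardy-Littlewood-Sobolev inequality at it.

  Because only finiteness is needed, the critical case has a short proof. With \<open>H = 1 / \<bar>x - t\<bar>\<close>, the
  integrand \<open>F powr \<alpha> * G powr \<beta> * H powr \<kappa>\<close> is homogeneous of degree 2, and comparing everything with the
  largest of \<open>F\<close>, \<open>G\<close>, \<open>H\<close> bounds it by
  \<open>F * G + F\<^sup>2 * \<phi> (F * \<bar>x - t\<bar>) + G\<^sup>2 * \<psi> (G * \<bar>x - t\<bar>)\<close> with integrable profiles \<open>\<phi>\<close>, \<open>\<psi>\<close>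
  (\<open>critical_split\<close>). Integrating the second term in \<open>t\<close> gives, by scaling, a constant times \<open>F x\<close>;
  the third is treated alike, and both are integrable.

  Convergence almost everywhere of the fractional integrals themselves is the same statement with \<open>f\<close>
  or \<open>g\<close> replaced by \<open>1\<close>.
\<close>

section \<open>Dilated profiles\<close>

text \<open>
  Powers are integrated in closed form on the positive half-line; kernels in the distance
  \<open>\<bar>x - t\<bar>\<close> are reduced to them by folding the line.
\<close>
lemma nn_integral_even_function:
  fixes h :: "real \<Rightarrow> real"
  assumes [measurable]: "h \<in> borel_measurable borel"
  shows "(\<integral>\<^sup>+ y. ennreal (h \<bar>y\<bar>) \<partial>lborel) \<le> 2 * (\<integral>\<^sup>+ y. ennreal (h y) * indicator {0..} y \<partial>lborel)"
proof -
  have "(\<integral>\<^sup>+ y. ennreal (h \<bar>y\<bar>) \<partial>lborel)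
      \<le> (\<integral>\<^sup>+ y. ennreal (h y) * indicator {0..} y + ennreal (h (-y)) * indicator {0..} (-y) \<partial>lborel)"
    by (intro nn_integral_mono) (auto simp: abs_if indicator_def)
  also have "\<dots> = (\<integral>\<^sup>+ y. ennreal (h y) * indicator {0..} y \<partial>lborel)
      + (\<integral>\<^sup>+ y. ennreal (h (-y)) * indicator {0..} (-y) \<partial>lborel)"
    by (intro nn_integral_add) auto
  also have "(\<integral>\<^sup>+ y. ennreal (h (-y)) * indicator {0..} (-y) \<partial>lborel)
      = (\<integral>\<^sup>+ y. ennreal (h y) * indicator {0..} y \<partial>lborel)"
    using nn_integral_real_affine[of "\<lambda>y. ennreal (h y) * indicator {0..} y" "-1" 0] by simp
  finally show ?thesis by (simp add: mult_2)
qed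

text \<open>
  In dimension one the Riesz kernel \<open>d powr (-\<kappa>)\<close> with \<open>\<kappa> < 1\<close> is integrable near \<open>0\<close> but not near
  \<open>\<infinity>\<close>. The profile follows it up to \<open>d = 1\<close> and continues with another exponent \<open>\<sigma>\<close>: for \<open>\<sigma> > 1\<close>
  it is integrable on the whole line, and for \<open>\<sigma> = 0\<close> the local singularity is continued by the constant \<open>1\<close>.
\<close>
definition riesz_profile :: "real \<Rightarrow> real \<Rightarrow> real \<Rightarrow> real" where
  "riesz_profile \<kappa> \<sigma> y = (if y \<le> 1 then y powr (-\<kappa>) else y powr (-\<sigma>))"

lemma riesz_profile_nonneg: "0 \<le> riesz_profile \<kappa> \<sigma> y"
  by (simp add: riesz_profile_def)

lemma riesz_profile_measurable [measurable]: "riesz_profile \<kappa> \<sigma> \<in> borel_measurable borel"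
  unfolding riesz_profile_def[abs_def] by measurable

lemma riesz_profile_integral_finite:
  assumes "\<kappa> < 1" "1 < \<sigma>"
  shows "(\<integral>\<^sup>+ y. ennreal (riesz_profile \<kappa> \<sigma> \<bar>y\<bar>) \<partial>lborel) < \<infinity>"
proof -
  have 1: "(\<integral>\<^sup>+ y. ennreal (y powr (-\<kappa>)) * indicator {0..1} y \<partial>lborel) < \<infinity>"
    by (subst nn_integral_has_integral_lebesgue'[OF _ has_integral_powr_from_0]) (use assms in auto)
  have 2: "(\<integral>\<^sup>+ y. ennreal (y powr (-\<sigma>)) * indicator {1..} y \<partial>lborel) < \<infinity>"
    by (subst nn_integral_has_integral_lebesgue'[OF _ has_integral_powr_to_inf]) (use assms in auto)
  have "(\<integral>\<^sup>+ y. ennreal (riesz_profile \<kappa> \<sigma> y) * indicator {0..} y \<partial>lborel)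
    \<le> (\<integral>\<^sup>+ y. ennreal (y powr (-\<kappa>)) * indicator {0..1} y
            + ennreal (y powr (-\<sigma>)) * indicator {1..} y \<partial>lborel)"
    by (intro nn_integral_mono) (auto simp: riesz_profile_def indicator_def)
  also have "\<dots> = (\<integral>\<^sup>+ y. ennreal (y powr (-\<kappa>)) * indicator {0..1} y \<partial>lborel)
            + (\<integral>\<^sup>+ y. ennreal (y powr (-\<sigma>)) * indicator {1..} y \<partial>lborel)"
    by (intro nn_integral_add) auto
  also have "\<dots> < \<infinity>"
    using 1 2 by (simp add: less_top[symmetric])
  finally have 3: "2 * (\<integral>\<^sup>+ y. ennreal (riesz_profile \<kappa> \<sigma> y) * indicator {0..} y \<partial>lborel) < \<infinity>"
    by (simp add: ennreal_mult_less_top)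
  show ?thesis
    by (rule le_less_trans[OF nn_integral_even_function 3]) measurable
qed

text \<open>
  Scaling: in one dimension the factor \<open>T\<^sup>2\<close> is one power of \<open>T\<close> more than the dilation consumes, so
  one factor \<open>T\<close> survives. With \<open>T = F x\<close> the inner integral is thus a multiple of \<open>F x\<close>, which is
  what makes the double integrals below finite for an integrable \<open>F\<close>.
\<close>
lemma nn_integral_dilated_profile:
  fixes T x :: real
  assumes T: "T > 0" and [measurable]: "\<phi> \<in> borel_measurable borel"
  shows "(\<integral>\<^sup>+ t. ennreal (T\<^sup>2 * \<phi> (T * \<bar>x - t\<bar>)) \<partial>lebesgue_on {a..b})
      \<le> ennreal T * (\<integral>\<^sup>+ y. ennreal (\<phi> \<bar>y\<bar>) \<partial>lborel)"
proof -
  have "(\<integral>\<^sup>+ t. ennreal (T\<^sup>2 * \<phi> (T * \<bar>x - t\<bar>)) \<partial>lebesgue_on {a..b})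
     \<le> (\<integral>\<^sup>+ t. ennreal (T\<^sup>2 * \<phi> (T * \<bar>x - t\<bar>)) \<partial>lebesgue)"
    by (subst nn_integral_restrict_space) (auto intro!: nn_integral_mono simp: indicator_def)
  also have "\<dots> = (\<integral>\<^sup>+ t. ennreal (T\<^sup>2 * \<phi> (T * \<bar>x - t\<bar>)) \<partial>lborel)"
    by (rule nn_integral_completion)
  also have "\<dots> = ennreal \<bar>1/T\<bar> * (\<integral>\<^sup>+ y. ennreal (T\<^sup>2 * \<phi> (T * \<bar>x - (x + 1/T * y)\<bar>)) \<partial>lborel)"
    by (rule nn_integral_real_affine) (use T in auto)
  also have "(\<lambda>y. T * \<bar>x - (x + 1/T * y)\<bar>) = (\<lambda>y. \<bar>y\<bar>)"
    using T by (auto simp: fun_eq_iff abs_mult)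
  also have "(\<integral>\<^sup>+ y. ennreal (T\<^sup>2 * \<phi> \<bar>y\<bar>) \<partial>lborel) = ennreal (T\<^sup>2) * (\<integral>\<^sup>+ y. ennreal (\<phi> \<bar>y\<bar>) \<partial>lborel)"
    by (simp add: ennreal_mult' nn_integral_cmult)
  also have "ennreal \<bar>1/T\<bar> * (ennreal (T\<^sup>2) * (\<integral>\<^sup>+ y. ennreal (\<phi> \<bar>y\<bar>) \<partial>lborel))
     = ennreal (1/T * T\<^sup>2) * (\<integral>\<^sup>+ y. ennreal (\<phi> \<bar>y\<bar>) \<partial>lborel)"
    using T by (subst ennreal_mult) (auto simp: mult.assoc)
  also have "1/T * T\<^sup>2 = T" using T by (simp add: power2_eq_square)
  finally show ?thesis .
qed

section \<open>Pointwise splitting of the product\<close>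

text \<open>
  The critical case by pointwise inequalities only. Put \<open>H = 1/d\<close>; the product
  \<open>F powr \<alpha> * G powr \<beta> * H powr \<kappa>\<close> is homogeneous of degree 2 in \<open>(F, G, H)\<close>, and the largest of the
  three is used as the unit. Here \<open>G \<le> F\<close>. If \<open>H\<close> is the largest, \<open>G\<close> is replaced by \<open>F\<close>, which leaves
  \<open>F\<^sup>2 * (F d) powr (-\<kappa>)\<close>, the part of the profile with \<open>F d \<le> 1\<close>. If \<open>F\<close> is the largest, the
  product is \<open>F\<^sup>2\<close> times powers of \<open>G/F\<close> and \<open>H/F = 1/(F d)\<close>, and Young's inequality with weights
  \<open>\<beta>\<close> and \<open>1 - \<beta>\<close> makes the power of \<open>G/F\<close> linear. This turns \<open>\<kappa>\<close> into \<open>\<kappa>/(1 - \<beta>)\<close>, which exceeds \<open>1\<close>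
  exactly because \<open>\<alpha> < 1\<close>: the tail of the profile becomes integrable.
\<close>
lemma critical_split_larger_first:
  fixes F G d \<alpha> \<beta> \<kappa> :: real
  assumes "1 \<le> G" "G \<le> F" "0 < d" "0 \<le> \<alpha>" "\<alpha> < 1" "0 \<le> \<beta>" "\<beta> < 1"
    and crit: "\<alpha> + \<beta> + \<kappa> = 2"
  shows "F powr \<alpha> * G powr \<beta> * d powr (-\<kappa>) \<le> F * G + F\<^sup>2 * riesz_profile \<kappa> (\<kappa> / (1 - \<beta>)) (F * d)"
proof -
  have F: "F > 0" and G: "G > 0" using assms by auto
  have eq: "F\<^sup>2 * (F * d) powr (-\<kappa>) = F powr (\<alpha> + \<beta>) * d powr (-\<kappa>)"
  proof -
    have "F\<^sup>2 * F powr (-\<kappa>) = F powr (2 + -\<kappa>)"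
      using F by (simp only: powr_add powr_numeral)
    also have "2 + -\<kappa> = \<alpha> + \<beta>" using crit by simp
    finally have "F\<^sup>2 * F powr (-\<kappa>) = F powr (\<alpha> + \<beta>)" .
    then show ?thesis using F assms(3) by (simp add: powr_mult)
  qed
  show ?thesis
  proof (cases "F * d \<le> 1")
    case True
    have "F powr \<alpha> * G powr \<beta> * d powr (-\<kappa>) \<le> F powr \<alpha> * F powr \<beta> * d powr (-\<kappa>)"
      using assms F G by (intro mult_right_mono mult_left_mono powr_mono2) auto
    also have "\<dots> = F\<^sup>2 * (F * d) powr (-\<kappa>)" by (simp add: eq powr_add)
    finally show ?thesis using True F G
      by (simp add: riesz_profile_def) (smt (verit) mult_nonneg_nonneg)
  next
    case False
    have "F powr \<alpha> * G powr \<beta> * d powr (-\<kappa>) = F powr (\<alpha> + \<beta>) * d powr (-\<kappa>) * (G / F) powr \<beta>"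
      using F G by (simp add: powr_add powr_divide)
    also have "\<dots> = F\<^sup>2 * ((G / F) powr \<beta> * ((F * d) powr (- (\<kappa> / (1 - \<beta>)))) powr (1 - \<beta>))"
      using assms by (simp add: eq[symmetric] powr_powr)
    also have "\<dots> \<le> F\<^sup>2 * (\<beta> * (G / F) + (1 - \<beta>) * (F * d) powr (- (\<kappa> / (1 - \<beta>))))"
      using assms F G by (intro mult_left_mono Youngs_inequality_0) auto
    also have "\<dots> \<le> F\<^sup>2 * (G / F + (F * d) powr (- (\<kappa> / (1 - \<beta>))))"
      using assms F G by (intro mult_left_mono add_mono mult_left_le_one_le) auto
    also have "\<dots> = F * G + F\<^sup>2 * riesz_profile \<kappa> (\<kappa> / (1 - \<beta>)) (F * d)"
      using F False by (simp add: riesz_profile_def distrib_left power2_eq_square)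
    finally show ?thesis .
  qed
qed

lemma critical_split:
  fixes F G d \<alpha> \<beta> \<kappa> :: real
  assumes "1 \<le> F" "1 \<le> G" "0 < d" "0 \<le> \<alpha>" "\<alpha> < 1" "0 \<le> \<beta>" "\<beta> < 1"
    and crit: "\<alpha> + \<beta> + \<kappa> = 2"
  shows "F powr \<alpha> * G powr \<beta> * d powr (-\<kappa>) \<le> F * G
      + F\<^sup>2 * riesz_profile \<kappa> (\<kappa> / (1 - \<beta>)) (F * d) + G\<^sup>2 * riesz_profile \<kappa> (\<kappa> / (1 - \<alpha>)) (G * d)"
proof (cases "G \<le> F")
  case True
  have "0 \<le> G\<^sup>2 * riesz_profile \<kappa> (\<kappa> / (1 - \<alpha>)) (G * d)" by (simp add: riesz_profile_nonneg)
  then show ?thesis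
    using critical_split_larger_first[of G F d \<alpha> \<beta> \<kappa>] True assms by auto
next
  case False
  have "0 \<le> F\<^sup>2 * riesz_profile \<kappa> (\<kappa> / (1 - \<beta>)) (F * d)" by (simp add: riesz_profile_nonneg)
  then show ?thesis
    using critical_split_larger_first[of F G d \<beta> \<alpha> \<kappa>] False assms by (auto simp: mult_ac add_ac)
qed

text \<open>
  The case of exponent \<open>1\<close> on \<open>F\<close>. Young's inequality is applied to the other two factors alone;
  if \<open>\<beta> + \<kappa> < 1\<close> the resulting exponent \<open>\<kappa>/(1 - \<beta>)\<close> stays below \<open>1\<close>, so the singularity remains
  integrable uniformly in the other variable.
\<close>
lemma endpoint_split:
  fixes F G d \<beta> \<kappa> :: real
  assumes "1 \<le> F" "1 \<le> G" "0 < d" "0 \<le> \<beta>" "\<beta> < 1" "0 \<le> \<kappa>"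
  shows "F * G powr \<beta> * d powr (-\<kappa>) \<le> F * G + F * riesz_profile (\<kappa> / (1 - \<beta>)) 0 d"
proof -
  have "G powr \<beta> * d powr (-\<kappa>) = G powr \<beta> * (d powr (- (\<kappa> / (1 - \<beta>)))) powr (1 - \<beta>)"
    using assms by (simp add: powr_powr)
  also have "\<dots> \<le> \<beta> * G + (1 - \<beta>) * d powr (- (\<kappa> / (1 - \<beta>)))"
    using assms by (intro Youngs_inequality_0) auto
  also have "\<dots> \<le> G + d powr (- (\<kappa> / (1 - \<beta>)))"
    using assms by (intro add_mono mult_left_le_one_le) auto
  also have "d powr (- (\<kappa> / (1 - \<beta>))) \<le> riesz_profile (\<kappa> / (1 - \<beta>)) 0 d"
    using assms powr_mono[of "- (\<kappa> / (1 - \<beta>))" 0 d] by (auto simp: riesz_profile_def)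
  finally have "F * (G powr \<beta> * d powr (-\<kappa>)) \<le> F * (G + riesz_profile (\<kappa> / (1 - \<beta>)) 0 d)"
    using assms by (intro mult_left_mono) auto
  then show ?thesis by (simp add: algebra_simps)
qed

section \<open>The Hardy-Littlewood-Sobolev bound on an interval\<close>

lemma finite_lebesgue_on_interval: "finite_measure (lebesgue_on {a..b::real})"
  by (rule finite_measure_lebesgue_on) auto

lemma pair_sigma_finite_interval:
  "pair_sigma_finite (lebesgue_on {a..b::real}) (lebesgue_on {c..d::real})"
  using finite_lebesgue_on_interval
  by (simp add: pair_sigma_finite_def finite_measure_def)

text \<open>
  The product of two Lebesgue (not Borel) spaces makes the coordinates Borel measurable, so that
  Borel kernels and Lebesgue measurable factors can be combined.
\<close>
lemma pair_interval_coordinates_measurable [measurable]: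
  fixes a b c d :: real
  shows "fst \<in> borel_measurable (lebesgue_on {a..b} \<Otimes>\<^sub>M lebesgue_on {c..d})"
    and "snd \<in> borel_measurable (lebesgue_on {a..b} \<Otimes>\<^sub>M lebesgue_on {c..d})"
  using measurable_compose[OF measurable_fst id_borel_measurable_lebesgue_on[unfolded id_def]]
    measurable_compose[OF measurable_snd id_borel_measurable_lebesgue_on[unfolded id_def]] by auto

lemma
  fixes F :: "real \<Rightarrow> real" and a b :: real
  defines "M \<equiv> lebesgue_on {a..b}"
  assumes F[measurable]: "F \<in> borel_measurable M" and pos: "\<And>x. 0 < F x"
    and fin: "(\<integral>\<^sup>+ x. ennreal (F x) \<partial>M) < \<infinity>"
    and [measurable]: "\<phi> \<in> borel_measurable borel"
    and fin\<phi>: "(\<integral>\<^sup>+ y. ennreal (\<phi> \<bar>y\<bar>) \<partial>lborel) < \<infinity>"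
  shows dilated_kernel_finite_fst:
      "(\<integral>\<^sup>+ z. ennreal ((F (fst z))\<^sup>2 * \<phi> (F (fst z) * \<bar>fst z - snd z\<bar>)) \<partial>(M \<Otimes>\<^sub>M M)) < \<infinity>"
    and dilated_kernel_finite_snd:
      "(\<integral>\<^sup>+ z. ennreal ((F (snd z))\<^sup>2 * \<phi> (F (snd z) * \<bar>fst z - snd z\<bar>)) \<partial>(M \<Otimes>\<^sub>M M)) < \<infinity>"
proof -
  interpret pair_sigma_finite M M
    unfolding M_def by (rule pair_sigma_finite_interval)
  note [measurable] = pair_interval_coordinates_measurable[of a b a b, folded M_def]
  have "(\<integral>\<^sup>+ x. \<integral>\<^sup>+ t. ennreal ((F x)\<^sup>2 * \<phi> (F x * \<bar>x - t\<bar>)) \<partial>M \<partial>M)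
      \<le> (\<integral>\<^sup>+ x. ennreal (F x) * (\<integral>\<^sup>+ y. ennreal (\<phi> \<bar>y\<bar>) \<partial>lborel) \<partial>M)"
    unfolding M_def by (intro nn_integral_mono nn_integral_dilated_profile pos) measurable
  also have "\<dots> < \<infinity>"
    using fin fin\<phi> by (simp add: nn_integral_multc ennreal_mult_less_top)
  finally have *: "(\<integral>\<^sup>+ x. \<integral>\<^sup>+ t. ennreal ((F x)\<^sup>2 * \<phi> (F x * \<bar>x - t\<bar>)) \<partial>M \<partial>M) < \<infinity>" .
  show "(\<integral>\<^sup>+ z. ennreal ((F (fst z))\<^sup>2 * \<phi> (F (fst z) * \<bar>fst z - snd z\<bar>)) \<partial>(M \<Otimes>\<^sub>M M)) < \<infinity>"
    by (subst M1.nn_integral_fst[symmetric], measurable) (use * in simp)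
  show "(\<integral>\<^sup>+ z. ennreal ((F (snd z))\<^sup>2 * \<phi> (F (snd z) * \<bar>fst z - snd z\<bar>)) \<partial>(M \<Otimes>\<^sub>M M)) < \<infinity>"
    by (subst nn_integral_snd[symmetric], measurable) (use * in \<open>simp add: abs_minus_commute\<close>)
qed

lemma nn_integral_product_finite:
  assumes "pair_sigma_finite M N"
    and [measurable]: "F \<in> borel_measurable M" "G \<in> borel_measurable N"
    and "(\<integral>\<^sup>+ x. F x \<partial>M) < \<infinity>" "(\<integral>\<^sup>+ x. G x \<partial>N) < \<infinity>"
  shows "(\<integral>\<^sup>+ z. F (fst z) * G (snd z) \<partial>(M \<Otimes>\<^sub>M N)) < \<infinity>"
proof -
  interpret pair_sigma_finite M N by fact
  have "(\<integral>\<^sup>+ z. F (fst z) * G (snd z) \<partial>(M \<Otimes>\<^sub>M N)) = (\<integral>\<^sup>+ x. F x * (\<integral>\<^sup>+ y. G y \<partial>N) \<partial>M)"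
    by (subst M2.nn_integral_fst[symmetric]) (auto simp: nn_integral_cmult)
  also have "\<dots> = (\<integral>\<^sup>+ x. F x \<partial>M) * (\<integral>\<^sup>+ y. G y \<partial>N)"
    by (simp add: nn_integral_multc)
  finally show ?thesis using assms by (simp add: ennreal_mult_less_top)
qed

lemma nn_integral_le_sum_finite:
  assumes "\<And>z. z \<in> space M \<Longrightarrow> h z \<le> u z + v z"
    and "u \<in> borel_measurable M" "v \<in> borel_measurable M"
    and "(\<integral>\<^sup>+ z. u z \<partial>M) < \<infinity>" "(\<integral>\<^sup>+ z. v z \<partial>M) < \<infinity>"
  shows "(\<integral>\<^sup>+ z. h z \<partial>M) < \<infinity>"
proof -
  have "(\<integral>\<^sup>+ z. h z \<partial>M) \<le> (\<integral>\<^sup>+ z. u z + v z \<partial>M)"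
    by (intro nn_integral_mono assms)
  also have "\<dots> = (\<integral>\<^sup>+ z. u z \<partial>M) + (\<integral>\<^sup>+ z. v z \<partial>M)"
    by (intro nn_integral_add assms)
  also have "\<dots> < \<infinity>" using assms by simp
  finally show ?thesis .
qed

text \<open>
  The Hardy-Littlewood-Sobolev inequality in qualitative form, for \<open>F\<close> and \<open>G\<close> read as
  \<open>\<bar>f\<bar> powr p\<close> and \<open>\<bar>g\<bar> powr q\<close>. Each of the two profile terms of the pointwise splitting
  depends on only one of the functions, hence can be integrated first in the other variable.
\<close>
lemma riesz_potential_finite_critical:
  fixes F G :: "real \<Rightarrow> real" and a b :: real
  defines "M \<equiv> lebesgue_on {a..b}"
  assumes F[measurable]: "F \<in> borel_measurable M" and F1: "\<And>x. 1 \<le> F x"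
    and G[measurable]: "G \<in> borel_measurable M" and G1: "\<And>x. 1 \<le> G x"
    and Ffin: "(\<integral>\<^sup>+ x. ennreal (F x) \<partial>M) < \<infinity>" and Gfin: "(\<integral>\<^sup>+ x. ennreal (G x) \<partial>M) < \<infinity>"
    and "0 \<le> \<alpha>" "\<alpha> < 1" "0 \<le> \<beta>" "\<beta> < 1" "\<kappa> < 1" "\<alpha> + \<beta> + \<kappa> = 2"
  shows "(\<integral>\<^sup>+ z. ennreal (F (fst z) powr \<alpha> * G (snd z) powr \<beta> * \<bar>fst z - snd z\<bar> powr (-\<kappa>)) \<partial>(M \<Otimes>\<^sub>M M)) < \<infinity>"
proof -
  note [measurable] = pair_interval_coordinates_measurable[of a b a b, folded M_def]
  let ?\<phi> = "riesz_profile \<kappa> (\<kappa> / (1 - \<beta>))" and ?\<psi> = "riesz_profile \<kappa> (\<kappa> / (1 - \<alpha>))"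
  have F0: "0 < F x" and G0: "0 < G x" for x using F1[of x] G1[of x] by auto
  have fin1: "(\<integral>\<^sup>+ z. ennreal (F (fst z)) * ennreal (G (snd z)) \<partial>(M \<Otimes>\<^sub>M M)) < \<infinity>"
    using Ffin Gfin unfolding M_def
    by (intro nn_integral_product_finite pair_sigma_finite_interval) (use F G M_def in auto)
  have fin2: "(\<integral>\<^sup>+ z. ennreal ((F (fst z))\<^sup>2 * ?\<phi> (F (fst z) * \<bar>fst z - snd z\<bar>)) \<partial>(M \<Otimes>\<^sub>M M)) < \<infinity>"
    unfolding M_def using assms F0
    by (intro dilated_kernel_finite_fst riesz_profile_integral_finite) (auto simp: field_simps)
  have fin3: "(\<integral>\<^sup>+ z. ennreal ((G (snd z))\<^sup>2 * ?\<psi> (G (snd z) * \<bar>fst z - snd z\<bar>)) \<partial>(M \<Otimes>\<^sub>M M)) < \<infinity>"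
    unfolding M_def using assms G0
    by (intro dilated_kernel_finite_snd riesz_profile_integral_finite) (auto simp: field_simps)
  have fin12: "(\<integral>\<^sup>+ z. ennreal (F (fst z)) * ennreal (G (snd z))
       + ennreal ((F (fst z))\<^sup>2 * ?\<phi> (F (fst z) * \<bar>fst z - snd z\<bar>)) \<partial>(M \<Otimes>\<^sub>M M)) < \<infinity>"
    by (rule nn_integral_le_sum_finite[OF order_refl _ _ fin1 fin2]) measurable
  show ?thesis
  proof (rule nn_integral_le_sum_finite[OF _ _ _ fin12 fin3])
    \<comment> \<open>On the diagonal the left-hand side is \<open>0\<close>, since \<open>0 powr e = 0\<close>.\<close>
    fix z :: "real \<times> real"
    let ?d = "\<bar>fst z - snd z\<bar>"
    show "ennreal (F (fst z) powr \<alpha> * G (snd z) powr \<beta> * ?d powr (-\<kappa>))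
       \<le> ennreal (F (fst z)) * ennreal (G (snd z)) + ennreal ((F (fst z))\<^sup>2 * ?\<phi> (F (fst z) * ?d))
         + ennreal ((G (snd z))\<^sup>2 * ?\<psi> (G (snd z) * ?d))"
    proof (cases "?d = 0")
      case False
      then have "F (fst z) powr \<alpha> * G (snd z) powr \<beta> * ?d powr (-\<kappa>)
         \<le> F (fst z) * G (snd z) + (F (fst z))\<^sup>2 * ?\<phi> (F (fst z) * ?d) + (G (snd z))\<^sup>2 * ?\<psi> (G (snd z) * ?d)"
        using assms by (intro critical_split F1 G1) auto
      then show ?thesis
        using F0[of "fst z"] G0[of "snd z"]
        by (subst ennreal_mult[symmetric], simp, simp, subst ennreal_plus[symmetric])
           (auto simp flip: ennreal_plus simp: riesz_profile_nonneg intro!: ennreal_leI)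
    qed simp
  qed measurable
qed

text \<open>
  The profile with \<open>\<sigma> = 0\<close> is dominated by an integrable one plus the constant \<open>1\<close>, and the interval
  has finite measure.
\<close>
lemma riesz_profile_bounded_integral:
  assumes "\<kappa> < 1"
  obtains K where "K < \<infinity>"
    "\<And>x. (\<integral>\<^sup>+ t. ennreal (riesz_profile \<kappa> 0 \<bar>x - t\<bar>) \<partial>lebesgue_on {a..b}) \<le> K"
proof
  let ?I = "(\<integral>\<^sup>+ y. ennreal (riesz_profile \<kappa> 2 \<bar>y\<bar>) \<partial>lborel)"
  let ?M = "lebesgue_on {a..b}"
  interpret finite_measure ?M by (rule finite_lebesgue_on_interval)
  show "?I + emeasure ?M (space ?M) < \<infinity>"
  proof -
    have "?I < top" using riesz_profile_integral_finite[of \<kappa> 2] assms by simp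
    moreover have "emeasure ?M (space ?M) < top"
      using emeasure_finite[of "space ?M"] unfolding less_top infinity_ennreal_def .
    ultimately show ?thesis by (simp only: infinity_ennreal_def ennreal_add_less_top)
  qed
  fix x
  have [measurable]: "(\<lambda>t. t) \<in> borel_measurable ?M" by (rule id_borel_measurable_lebesgue_on[unfolded id_def])
  have "(\<integral>\<^sup>+ t. ennreal (riesz_profile \<kappa> 0 \<bar>x - t\<bar>) \<partial>?M)
     \<le> (\<integral>\<^sup>+ t. ennreal (riesz_profile \<kappa> 2 \<bar>x - t\<bar>) + 1 \<partial>?M)"
    by (intro nn_integral_mono)
       (auto simp: riesz_profile_def simp flip: ennreal_1 ennreal_plus intro!: ennreal_leI)
  also have "\<dots> = (\<integral>\<^sup>+ t. ennreal (riesz_profile \<kappa> 2 \<bar>x - t\<bar>) \<partial>?M) + emeasure ?M (space ?M)"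
    by (subst nn_integral_add) auto
  also have "\<dots> \<le> ?I + emeasure ?M (space ?M)"
    using nn_integral_dilated_profile[where T = 1 and \<phi> = "riesz_profile \<kappa> 2" and x = x and a = a and b = b] by (intro add_right_mono) auto
  finally show "(\<integral>\<^sup>+ t. ennreal (riesz_profile \<kappa> 0 \<bar>x - t\<bar>) \<partial>?M) \<le> \<dots>" .
qed

lemma riesz_potential_finite_endpoint:
  fixes F G :: "real \<Rightarrow> real" and a b :: real
  defines "M \<equiv> lebesgue_on {a..b}"
  assumes F[measurable]: "F \<in> borel_measurable M" and F1: "\<And>x. 1 \<le> F x"
    and G[measurable]: "G \<in> borel_measurable M" and G1: "\<And>x. 1 \<le> G x"
    and Ffin: "(\<integral>\<^sup>+ x. ennreal (F x) \<partial>M) < \<infinity>" and Gfin: "(\<integral>\<^sup>+ x. ennreal (G x) \<partial>M) < \<infinity>"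
    and "0 \<le> \<beta>" "\<beta> < 1" "0 \<le> \<kappa>" "\<beta> + \<kappa> < 1"
  shows "(\<integral>\<^sup>+ z. ennreal (F (fst z) * G (snd z) powr \<beta> * \<bar>fst z - snd z\<bar> powr (-\<kappa>)) \<partial>(M \<Otimes>\<^sub>M M)) < \<infinity>"
proof -
  interpret pair_sigma_finite M M
    unfolding M_def by (rule pair_sigma_finite_interval)
  note [measurable] = pair_interval_coordinates_measurable[of a b a b, folded M_def]
  let ?\<phi> = "riesz_profile (\<kappa> / (1 - \<beta>)) 0"
  have F0: "0 < F x" and G0: "0 < G x" for x using F1[of x] G1[of x] by auto
  obtain K where K: "K < \<infinity>" "\<And>x. (\<integral>\<^sup>+ t. ennreal (?\<phi> \<bar>x - t\<bar>) \<partial>M) \<le> K"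
    using riesz_profile_bounded_integral[of "\<kappa> / (1 - \<beta>)" a b] assms(8-11)
    unfolding M_def by (auto simp: field_simps)
  have fin1: "(\<integral>\<^sup>+ z. ennreal (F (fst z)) * ennreal (G (snd z)) \<partial>(M \<Otimes>\<^sub>M M)) < \<infinity>"
    using Ffin Gfin unfolding M_def
    by (intro nn_integral_product_finite pair_sigma_finite_interval) (use F G M_def in auto)
  have "(\<integral>\<^sup>+ x. \<integral>\<^sup>+ t. ennreal (F x) * ennreal (?\<phi> \<bar>x - t\<bar>) \<partial>M \<partial>M) \<le> (\<integral>\<^sup>+ x. ennreal (F x) * K \<partial>M)"
  proof (intro nn_integral_mono)
    fix x
    have [measurable]: "(\<lambda>t. t) \<in> borel_measurable M" unfolding M_def by (rule id_borel_measurable_lebesgue_on[unfolded id_def])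
    have "(\<integral>\<^sup>+ t. ennreal (F x) * ennreal (?\<phi> \<bar>x - t\<bar>) \<partial>M) = ennreal (F x) * (\<integral>\<^sup>+ t. ennreal (?\<phi> \<bar>x - t\<bar>) \<partial>M)"
      by (rule nn_integral_cmult) measurable
    also have "\<dots> \<le> ennreal (F x) * K" by (intro mult_left_mono K) auto
    finally show "(\<integral>\<^sup>+ t. ennreal (F x) * ennreal (?\<phi> \<bar>x - t\<bar>) \<partial>M) \<le> ennreal (F x) * K" .
  qed
  also have "\<dots> < \<infinity>"
    using Ffin K by (simp add: nn_integral_multc ennreal_mult_less_top)
  finally have fin2': "(\<integral>\<^sup>+ x. \<integral>\<^sup>+ t. ennreal (F x) * ennreal (?\<phi> \<bar>x - t\<bar>) \<partial>M \<partial>M) < \<infinity>" .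
  have fin2: "(\<integral>\<^sup>+ z. ennreal (F (fst z)) * ennreal (?\<phi> \<bar>fst z - snd z\<bar>) \<partial>(M \<Otimes>\<^sub>M M)) < \<infinity>"
    by (subst M1.nn_integral_fst[symmetric], measurable) (use fin2' in simp)
  show ?thesis
  proof (rule nn_integral_le_sum_finite[OF _ _ _ fin1 fin2])
    \<comment> \<open>On the diagonal the left-hand side is \<open>0\<close>, since \<open>0 powr e = 0\<close>.\<close>
    fix z :: "real \<times> real"
    let ?d = "\<bar>fst z - snd z\<bar>"
    show "ennreal (F (fst z) * G (snd z) powr \<beta> * ?d powr (-\<kappa>))
       \<le> ennreal (F (fst z)) * ennreal (G (snd z)) + ennreal (F (fst z)) * ennreal (?\<phi> ?d)"
    proof (cases "?d = 0")
      case False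
      then have "F (fst z) * G (snd z) powr \<beta> * ?d powr (-\<kappa>)
         \<le> F (fst z) * G (snd z) + F (fst z) * ?\<phi> ?d"
        using assms by (intro endpoint_split F1 G1) auto
      then show ?thesis
        using F0[of "fst z"] G0[of "snd z"]
        by (simp add: riesz_profile_nonneg ennreal_leI flip: ennreal_mult ennreal_plus)
    qed simp
  qed measurable
qed

lemma nn_integral_pair_swap:
  assumes "sigma_finite_measure M" "sigma_finite_measure N"
    and [measurable]: "h \<in> borel_measurable (M \<Otimes>\<^sub>M N)"
  shows "(\<integral>\<^sup>+ z. h z \<partial>(M \<Otimes>\<^sub>M N)) = (\<integral>\<^sup>+ z. h (snd z, fst z) \<partial>(N \<Otimes>\<^sub>M M))"
proof -
  interpret pair_sigma_finite M N
    using assms by (simp add: pair_sigma_finite_def)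
  show ?thesis
    by (subst distr_pair_swap) (simp add: nn_integral_distr split_def)
qed

text \<open>
  All admissible exponents reduce to the two cases above or to a bounded kernel. Since \<open>F\<close> and \<open>G\<close> are
  at least \<open>1\<close>, raising \<open>\<alpha>\<close> and \<open>\<beta>\<close> only enlarges the integrand. If both are below \<open>1\<close>, moving
  them along the segment towards \<open>(1, 1)\<close> reaches the critical sum \<open>2 - \<kappa>\<close> before the end point,
  because \<open>\<kappa> > 0\<close>. If one of them equals \<open>1\<close>, the sum is not critical and the end-point case applies.
\<close>
lemma riesz_potential_finite:
  fixes F G :: "real \<Rightarrow> real" and a b :: real
  defines "M \<equiv> lebesgue_on {a..b}"
  assumes F[measurable]: "F \<in> borel_measurable M" and F1: "\<And>x. 1 \<le> F x"
    and G[measurable]: "G \<in> borel_measurable M" and G1: "\<And>x. 1 \<le> G x"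
    and Ffin: "(\<integral>\<^sup>+ x. ennreal (F x) \<partial>M) < \<infinity>" and Gfin: "(\<integral>\<^sup>+ x. ennreal (G x) \<partial>M) < \<infinity>"
    and \<alpha>: "0 \<le> \<alpha>" "\<alpha> \<le> 1" and \<beta>: "0 \<le> \<beta>" "\<beta> \<le> 1" and \<kappa>: "\<kappa> < 1"
    and le2: "\<alpha> + \<beta> + \<kappa> \<le> 2" and crit: "\<alpha> + \<beta> + \<kappa> = 2 \<Longrightarrow> \<alpha> < 1 \<and> \<beta> < 1"
  shows "(\<integral>\<^sup>+ z. ennreal (F (fst z) powr \<alpha> * G (snd z) powr \<beta> * \<bar>fst z - snd z\<bar> powr (-\<kappa>)) \<partial>(M \<Otimes>\<^sub>M M)) < \<infinity>"
proof -
  have F0: "0 < F x" and G0: "0 < G x" for x using F1[of x] G1[of x] by auto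
  have sf: "sigma_finite_measure M"
    unfolding M_def using finite_lebesgue_on_interval[of a b] by (simp add: finite_measure_def)
  note [measurable] = pair_interval_coordinates_measurable[of a b a b, folded M_def]
  consider "\<kappa> \<le> 0" | "0 < \<kappa>" "\<alpha> = 1" | "0 < \<kappa>" "\<beta> = 1" | "0 < \<kappa>" "\<alpha> < 1" "\<beta> < 1"
    using \<alpha> \<beta> by fastforce
  then show ?thesis
  proof cases
    case 1
    \<comment> \<open>The kernel is bounded, and both exponents may be raised to \<open>1\<close>.\<close>
    let ?L = "\<bar>b - a\<bar> powr (-\<kappa>)"
    have "(\<integral>\<^sup>+ z. ennreal (F (fst z) powr \<alpha> * G (snd z) powr \<beta> * \<bar>fst z - snd z\<bar> powr (-\<kappa>)) \<partial>(M \<Otimes>\<^sub>M M))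
        \<le> (\<integral>\<^sup>+ z. ennreal ?L * (ennreal (F (fst z)) * ennreal (G (snd z))) \<partial>(M \<Otimes>\<^sub>M M))"
    proof (intro nn_integral_mono)
      fix z assume "z \<in> space (M \<Otimes>\<^sub>M M)"
      then have z: "\<bar>fst z - snd z\<bar> \<le> \<bar>b - a\<bar>"
        unfolding M_def by (auto simp: space_pair_measure)
      have "F (fst z) powr \<alpha> * G (snd z) powr \<beta> * \<bar>fst z - snd z\<bar> powr (-\<kappa>)
          \<le> F (fst z) powr 1 * G (snd z) powr 1 * ?L"
        using 1 z \<alpha> \<beta> F1 G1 by (intro mult_mono powr_mono powr_mono2) auto
      also have "\<dots> = ?L * (F (fst z) * G (snd z))"
        using F0[of "fst z"] G0[of "snd z"] by simp
      finally show "ennreal (F (fst z) powr \<alpha> * G (snd z) powr \<beta> * \<bar>fst z - snd z\<bar> powr (-\<kappa>))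
        \<le> ennreal ?L * (ennreal (F (fst z)) * ennreal (G (snd z)))"
        using F0[of "fst z"] G0[of "snd z"] by (simp add: ennreal_leI flip: ennreal_mult)
    qed
    also have "\<dots> = ennreal ?L * (\<integral>\<^sup>+ z. ennreal (F (fst z)) * ennreal (G (snd z)) \<partial>(M \<Otimes>\<^sub>M M))"
      by (rule nn_integral_cmult) measurable
    also have "\<dots> < \<infinity>"
    proof -
      have "(\<integral>\<^sup>+ z. ennreal (F (fst z)) * ennreal (G (snd z)) \<partial>(M \<Otimes>\<^sub>M M)) < \<infinity>"
        using Ffin Gfin unfolding M_def
        by (intro nn_integral_product_finite pair_sigma_finite_interval) (use F G M_def in auto)
      then show ?thesis by (simp add: ennreal_mult_less_top)
    qed
    finally show ?thesis .
  next
    case 2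
    then have "\<beta> + \<kappa> < 1" "\<beta> < 1" using crit le2 \<beta> by fastforce+
    then show ?thesis
      using riesz_potential_finite_endpoint[of F a b G \<beta> \<kappa>] 2 assms
      by (auto simp: order_less_imp_le[OF F0])
  next
    case 3
    then have "\<alpha> + \<kappa> < 1" "\<alpha> < 1" using crit le2 \<alpha> by fastforce+
    then have "(\<integral>\<^sup>+ z. ennreal (G (fst z) * F (snd z) powr \<alpha> * \<bar>fst z - snd z\<bar> powr (-\<kappa>)) \<partial>(M \<Otimes>\<^sub>M M)) < \<infinity>"
      using riesz_potential_finite_endpoint[of G a b F \<alpha> \<kappa>] 3 assms by auto
    also have "(\<integral>\<^sup>+ z. ennreal (G (fst z) * F (snd z) powr \<alpha> * \<bar>fst z - snd z\<bar> powr (-\<kappa>)) \<partial>(M \<Otimes>\<^sub>M M))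
      = (\<integral>\<^sup>+ z. ennreal (F (fst z) powr \<alpha> * G (snd z) powr \<beta> * \<bar>fst z - snd z\<bar> powr (-\<kappa>)) \<partial>(M \<Otimes>\<^sub>M M))"
      using 3 by (subst nn_integral_pair_swap[OF sf sf], measurable)
        (simp add: order_less_imp_le[OF G0] abs_minus_commute mult_ac)
    finally show ?thesis .
  next
    case 4
    \<comment> \<open>The parameter on the segment at which the sum of the exponents becomes critical.\<close>
    define \<tau> where "\<tau> = (2 - \<alpha> - \<beta> - \<kappa>) / (2 - \<alpha> - \<beta>)"
    have \<tau>: "0 \<le> \<tau>" "\<tau> < 1" "\<tau> * (2 - \<alpha> - \<beta>) = 2 - \<alpha> - \<beta> - \<kappa>"
      using 4 le2 by (auto simp: \<tau>_def)
    let ?\<alpha> = "\<alpha> + \<tau> * (1 - \<alpha>)" and ?\<beta> = "\<beta> + \<tau> * (1 - \<beta>)"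
    have lt1: "\<tau> * (1 - \<alpha>) < 1 - \<alpha>" "\<tau> * (1 - \<beta>) < 1 - \<beta>" using \<tau> 4 by auto
    have ge0: "0 \<le> \<tau> * (1 - \<alpha>)" "0 \<le> \<tau> * (1 - \<beta>)" using \<tau> 4 by auto
    have "?\<alpha> + ?\<beta> + \<kappa> = \<alpha> + \<beta> + \<kappa> + \<tau> * (2 - \<alpha> - \<beta>)" by (simp add: algebra_simps)
    then have sum2: "?\<alpha> + ?\<beta> + \<kappa> = 2" using \<tau> by simp
    have "(\<integral>\<^sup>+ z. ennreal (F (fst z) powr \<alpha> * G (snd z) powr \<beta> * \<bar>fst z - snd z\<bar> powr (-\<kappa>)) \<partial>(M \<Otimes>\<^sub>M M))
       \<le> (\<integral>\<^sup>+ z. ennreal (F (fst z) powr ?\<alpha> * G (snd z) powr ?\<beta> * \<bar>fst z - snd z\<bar> powr (-\<kappa>)) \<partial>(M \<Otimes>\<^sub>M M))"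
      using ge0 F1 G1 by (intro nn_integral_mono ennreal_leI mult_right_mono mult_mono powr_mono) auto
    also have "\<dots> < \<infinity>"
      unfolding M_def
    proof (rule riesz_potential_finite_critical[OF F[unfolded M_def] F1 G[unfolded M_def] G1
          Ffin[unfolded M_def] Gfin[unfolded M_def] _ _ _ _ \<kappa> sum2])
      show "0 \<le> ?\<alpha>" "?\<alpha> < 1" "0 \<le> ?\<beta>" "?\<beta> < 1" using lt1 ge0 \<alpha> \<beta> by linarith+
    qed
    finally show ?thesis .
  qed
qed

text \<open>
  The bounds on \<open>f\<close> and \<open>g\<close> are required only almost everywhere, as essential suprema provide no more. In
  iterated integrals such bounds can be used one variable at a time.
\<close>
lemma weakly_singular_product_integrable:
  fixes f g :: "real \<Rightarrow> complex" and F G :: "real \<Rightarrow> real" and k :: "real \<times> real \<Rightarrow> real" and a b :: real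
  defines "M \<equiv> lebesgue_on {a..b}"
  assumes f[measurable]: "f \<in> borel_measurable M" and g[measurable]: "g \<in> borel_measurable M"
    and k[measurable]: "k \<in> borel_measurable (M \<Otimes>\<^sub>M M)"
    and F[measurable]: "F \<in> borel_measurable M" and F1: "\<And>x. 1 \<le> F x"
    and G[measurable]: "G \<in> borel_measurable M" and G1: "\<And>x. 1 \<le> G x"
    and Ffin: "(\<integral>\<^sup>+ x. ennreal (F x) \<partial>M) < \<infinity>" and Gfin: "(\<integral>\<^sup>+ x. ennreal (G x) \<partial>M) < \<infinity>"
    and fF: "AE x in M. norm (f x) \<le> A * F x powr \<alpha>" and gG: "AE x in M. norm (g x) \<le> B * G x powr \<beta>"
    and kd: "\<And>x t. x \<in> {a..b} \<Longrightarrow> t \<in> {a..b} \<Longrightarrow> \<bar>k (x, t)\<bar> \<le> C * \<bar>x - t\<bar> powr (-\<kappa>)"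
    and ABC: "0 \<le> A" "0 \<le> B" "0 \<le> C"
    and \<alpha>: "0 \<le> \<alpha>" "\<alpha> \<le> 1" and \<beta>: "0 \<le> \<beta>" "\<beta> \<le> 1" and \<kappa>: "\<kappa> < 1"
    and le2: "\<alpha> + \<beta> + \<kappa> \<le> 2" and crit: "\<alpha> + \<beta> + \<kappa> = 2 \<Longrightarrow> \<alpha> < 1 \<and> \<beta> < 1"
  shows "integrable (M \<Otimes>\<^sub>M M) (\<lambda>(x, t). complex_of_real (k (x, t)) * f x * g t)"
proof (rule integrableI_bounded)
  interpret pair_sigma_finite M M
    unfolding M_def by (rule pair_sigma_finite_interval)
  note [measurable] = pair_interval_coordinates_measurable[of a b a b, folded M_def]
  let ?h = "\<lambda>z. complex_of_real (k z) * f (fst z) * g (snd z)"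
  let ?r = "\<lambda>z. ennreal (F (fst z) powr \<alpha> * G (snd z) powr \<beta> * \<bar>fst z - snd z\<bar> powr (-\<kappa>))"
  have eq: "(\<lambda>(x, t). complex_of_real (k (x, t)) * f x * g t) = ?h" by (simp add: split_def)
  have h: "?h \<in> borel_measurable (M \<Otimes>\<^sub>M M)" by measurable
  have r: "?r \<in> borel_measurable (M \<Otimes>\<^sub>M M)" by measurable
  show "(\<lambda>(x, t). complex_of_real (k (x, t)) * f x * g t) \<in> borel_measurable (M \<Otimes>\<^sub>M M)"
    unfolding eq by (rule h)
  have "(\<integral>\<^sup>+ z. ennreal (norm (?h z)) \<partial>(M \<Otimes>\<^sub>M M)) = (\<integral>\<^sup>+ x. \<integral>\<^sup>+ t. ennreal (norm (?h (x, t))) \<partial>M \<partial>M)"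
    using h by (intro M1.nn_integral_fst[symmetric]) measurable
  also have "\<dots> \<le> (\<integral>\<^sup>+ x. \<integral>\<^sup>+ t. ennreal (C * A * B) * ?r (x, t) \<partial>M \<partial>M)"
  proof (rule nn_integral_mono_AE)
    show "AE x in M. (\<integral>\<^sup>+ t. ennreal (norm (?h (x, t))) \<partial>M) \<le> (\<integral>\<^sup>+ t. ennreal (C * A * B) * ?r (x, t) \<partial>M)"
      using fF AE_space
    proof eventually_elim
      case (elim x)
      show ?case
      proof (rule nn_integral_mono_AE)
        show "AE t in M. ennreal (norm (?h (x, t))) \<le> ennreal (C * A * B) * ?r (x, t)"
          using gG AE_space
        proof eventually_elim
          case (elim t)
          have xt: "x \<in> {a..b}" "t \<in> {a..b}"
            using \<open>x \<in> space M\<close> elim by (auto simp: M_def)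
          have "norm (?h (x, t)) = \<bar>k (x, t)\<bar> * norm (f x) * norm (g t)" by (simp add: norm_mult)
          also have "\<dots> \<le> (C * \<bar>x - t\<bar> powr (-\<kappa>)) * (A * F x powr \<alpha>) * (B * G t powr \<beta>)"
            using ABC elim \<open>norm (f x) \<le> _\<close> kd[OF xt] by (intro mult_mono) auto
          also have "\<dots> = C * A * B * (F x powr \<alpha> * G t powr \<beta> * \<bar>x - t\<bar> powr (-\<kappa>))"
            by (simp add: mult_ac)
          finally have "ennreal (norm (?h (x, t))) \<le> ennreal \<dots>" by (rule ennreal_leI)
          also have "\<dots> = ennreal (C * A * B) * ?r (x, t)" using ABC by (simp add: ennreal_mult)
          finally show ?case .
        qed
      qed
    qed
  qed
  also have "\<dots> = (\<integral>\<^sup>+ z. ennreal (C * A * B) * ?r z \<partial>(M \<Otimes>\<^sub>M M))"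
    using r by (intro M1.nn_integral_fst) measurable
  also have "\<dots> = ennreal (C * A * B) * (\<integral>\<^sup>+ z. ?r z \<partial>(M \<Otimes>\<^sub>M M))"
    by (rule nn_integral_cmult[OF r])
  also have "\<dots> < \<infinity>"
  proof -
    have "(\<integral>\<^sup>+ z. ?r z \<partial>(M \<Otimes>\<^sub>M M)) < \<infinity>"
      unfolding M_def
      by (rule riesz_potential_finite) (use F F1 G G1 Ffin Gfin \<alpha> \<beta> \<kappa> le2 crit M_def in auto)
    then show ?thesis by (simp add: ennreal_mult_less_top)
  qed
  finally show "(\<integral>\<^sup>+ z. ennreal (norm ((\<lambda>(x, t). complex_of_real (k (x, t)) * f x * g t) z)) \<partial>(M \<Otimes>\<^sub>M M)) < \<infinity>"
    unfolding eq .
qed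

section \<open>Functions in the weighted spaces\<close>

text \<open>
  Where both weights are bounded below by a positive constant, the space embeds into the unweighted
  \<open>L\<^sup>p\<close> and its elements are bounded by \<open>A * F powr (1/p)\<close> with an
  integrable \<open>F \<ge> 1\<close>: \<open>F = 1 + \<bar>f\<bar> powr p\<close> for finite \<open>p\<close>, and \<open>F = 1\<close> with exponent \<open>0\<close> for
  \<open>p = \<infinity>\<close>. All exponents are treated at once from here on.
\<close>
lemma X_space_majorant:
  assumes f: "f \<in> X_space a b \<Psi> c p" and p: "1 \<le> p"
    and m: "0 < m" "\<And>x. x \<in> {a..b} \<Longrightarrow> m \<le> \<Psi> x powr c" "\<And>x. x \<in> {a..b} \<Longrightarrow> m \<le> log_deriv_on a b \<Psi> x"
  obtains F :: "real \<Rightarrow> real" and A \<alpha> where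
    "F \<in> borel_measurable (lebesgue_on {a..b})" "\<And>x. 1 \<le> F x"
    "(\<integral>\<^sup>+ x. ennreal (F x) \<partial>lebesgue_on {a..b}) < \<infinity>"
    "AE x in lebesgue_on {a..b}. norm (f x) \<le> A * F x powr \<alpha>"
    "0 \<le> A" "0 \<le> \<alpha>" "\<alpha> \<le> 1" "1 / p = ennreal \<alpha>" "\<alpha> = 1 \<longrightarrow> p = 1"
proof -
  let ?M = "lebesgue_on {a..b}"
  interpret finite_measure ?M by (rule finite_lebesgue_on_interval)
  have fin1: "emeasure ?M (space ?M) < \<infinity>"
    using emeasure_finite[of "space ?M"] unfolding less_top infinity_ennreal_def .
  have f_meas [measurable]: "f \<in> borel_measurable ?M" and norm_fin: "X_norm a b \<Psi> c p f < \<infinity>"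
    using f by (auto simp: X_space_def)
  show ?thesis
  proof (cases p)
    case top
    let ?e = "esssup ?M (\<lambda>x. ennreal (\<Psi> x powr c * norm (f x)))"
    have e: "?e < \<infinity>" using norm_fin top by (simp add: X_norm_def)
    have "AE x in ?M. norm (f x) \<le> enn2real ?e / m * (1::real) powr 0"
      using esssup_AE[of "\<lambda>x. ennreal (\<Psi> x powr c * norm (f x))" ?M] AE_space
    proof eventually_elim
      case (elim x)
      then have "x \<in> {a..b}" by simp
      then have "m * norm (f x) \<le> \<Psi> x powr c * norm (f x)" by (intro mult_right_mono m) auto
      also have "\<Psi> x powr c * norm (f x) \<le> enn2real ?e"
        using enn2real_mono[OF elim(1)] e by simp
      finally show ?case using m by (simp add: field_simps)
    qed
    moreover have "(\<integral>\<^sup>+ x. ennreal 1 \<partial>?M) < \<infinity>" using fin1 by simp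
    ultimately show ?thesis
      using m top by (intro that[of "\<lambda>_. 1" "enn2real ?e / m" 0]) (auto simp: ennreal_divide_top)
  next
    case (real r)
    have r: "1 \<le> r" using p real by (simp flip: ennreal_1)
    define I where "I = (\<integral>\<^sup>+ x. ennreal (norm (complex_of_real (\<Psi> x powr c) * f x) powr r
                                   * log_deriv_on a b \<Psi> x) \<partial>?M)"
    have I: "I < \<infinity>"
      using norm_fin real r unfolding X_norm_def I_def Let_def by (auto simp: less_top split: if_splits)
    let ?F = "\<lambda>x. 1 + norm (f x) powr r"
    have "ennreal (m powr r * m) * (\<integral>\<^sup>+ x. ennreal (norm (f x) powr r) \<partial>?M)
        = (\<integral>\<^sup>+ x. ennreal (m powr r * m) * ennreal (norm (f x) powr r) \<partial>?M)"
      by (rule nn_integral_cmult[symmetric]) measurable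
    also have "\<dots> \<le> I"
      unfolding I_def
    proof (rule nn_integral_mono)
      fix x assume "x \<in> space ?M"
      then have x: "x \<in> {a..b}" by simp
      have "m powr r * m * norm (f x) powr r = (m * norm (f x)) powr r * m"
        using m by (simp add: powr_mult)
      also have "\<dots> \<le> (\<Psi> x powr c * norm (f x)) powr r * log_deriv_on a b \<Psi> x"
        using m x r by (intro mult_mono powr_mono2) auto
      finally show "ennreal (m powr r * m) * ennreal (norm (f x) powr r)
         \<le> ennreal (norm (complex_of_real (\<Psi> x powr c) * f x) powr r * log_deriv_on a b \<Psi> x)"
        using m by (simp add: norm_mult ennreal_leI flip: ennreal_mult)
    qed
    also note I
    finally have J: "(\<integral>\<^sup>+ x. ennreal (norm (f x) powr r) \<partial>?M) < \<infinity>"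
      using m by (auto simp: ennreal_mult_less_top)
    have "(\<integral>\<^sup>+ x. ennreal (?F x) \<partial>?M) = (\<integral>\<^sup>+ x. 1 + ennreal (norm (f x) powr r) \<partial>?M)"
      by (simp add: ennreal_plus)
    also have "\<dots> = (\<integral>\<^sup>+ x. 1 \<partial>?M) + (\<integral>\<^sup>+ x. ennreal (norm (f x) powr r) \<partial>?M)"
      by (rule nn_integral_add) measurable
    also have "\<dots> < \<infinity>" using J fin1 by simp
    finally have Ffin: "(\<integral>\<^sup>+ x. ennreal (?F x) \<partial>?M) < \<infinity>" .
    have bound: "norm (f x) \<le> 1 * ?F x powr (1 / r)" for x
    proof -
      have "norm (f x) = (norm (f x) powr r) powr (1 / r)" using r by (simp add: powr_powr)
      also have "\<dots> \<le> ?F x powr (1 / r)" using r by (intro powr_mono2) auto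
      finally show ?thesis by simp
    qed
    show ?thesis
    proof (rule that[of ?F 1 "1 / r"])
      show "1 / p = ennreal (1 / r)"
        using real r divide_ennreal[of 1 r] by simp
      show "1 / r = 1 \<longrightarrow> p = 1" using real r by auto
      show "?F \<in> borel_measurable ?M" by measurable
    qed (use bound Ffin r in auto)
  qed
qed

section \<open>The Hadamard kernel\<close>

lemma continuous_positive_on_interval_bounds:
  fixes h :: "real \<Rightarrow> real"
  assumes "a \<le> b" "continuous_on {a..b} h" "\<And>x. x \<in> {a..b} \<Longrightarrow> 0 < h x"
  obtains m L where "0 < m" "m \<le> L" "\<And>x. x \<in> {a..b} \<Longrightarrow> m \<le> h x" "\<And>x. x \<in> {a..b} \<Longrightarrow> h x \<le> L"
proof -
  obtain x0 where x0: "x0 \<in> {a..b}" "\<forall>y\<in>{a..b}. h x0 \<le> h y"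
    using continuous_attains_inf[of "{a..b}" h] assms by auto
  obtain x1 where x1: "x1 \<in> {a..b}" "\<forall>y\<in>{a..b}. h y \<le> h x1"
    using continuous_attains_sup[of "{a..b}" h] assms by auto
  show thesis using that[of "h x0" "h x1"] x0 x1 assms by auto
qed

lemma deriv_on_nonneg:
  assumes "a < b" "x \<in> {a..b}" "mono_on {a..b} \<Psi>"
    and der: "(\<Psi> has_real_derivative D) (at x within {a..b})"
  shows "0 \<le> D"
proof (rule tendsto_lowerbound)
  show "((\<lambda>y. (\<Psi> y - \<Psi> x) / (y - x)) \<longlongrightarrow> D) (at x within {a..b})"
    using der by (simp add: has_field_derivative_iff)
  show "\<forall>\<^sub>F y in at x within {a..b}. 0 \<le> (\<Psi> y - \<Psi> x) / (y - x)"
    unfolding eventually_at_filter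
  proof (intro always_eventually allI impI)
    fix y assume "y \<noteq> x" "y \<in> {a..b}"
    then show "0 \<le> (\<Psi> y - \<Psi> x) / (y - x)"
      using mono_onD[OF assms(3), of x y] mono_onD[OF assms(3), of y x] assms(2)
      by (cases "x < y") (auto simp: divide_nonpos_neg)
  qed
  show "at x within {a..b} \<noteq> bot"
    using assms by (simp add: trivial_limit_within islimpt_Icc)
qed

text \<open>
  The sign of \<open>\<Psi>'\<close> follows from monotonicity, strictness from \<open>\<Psi>' \<noteq> 0\<close>. The weight \<open>\<Psi>'/\<Psi>\<close> is the
  derivative of \<open>ln \<circ> \<Psi>\<close>.
\<close>
lemma log_deriv_on_properties:
  assumes "a < b" "C1_on a b \<Psi>" "mono_on {a..b} \<Psi>"
    and pos: "\<And>x. x \<in> {a..b} \<Longrightarrow> 0 < \<Psi> x"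
    and nz: "\<And>x. x \<in> {a..b} \<Longrightarrow> deriv_on a b \<Psi> x \<noteq> 0"
  shows "continuous_on {a..b} \<Psi>" "continuous_on {a..b} (log_deriv_on a b \<Psi>)"
    and "\<And>x. x \<in> {a..b} \<Longrightarrow> 0 < log_deriv_on a b \<Psi> x"
    and "\<And>x. x \<in> {a..b} \<Longrightarrow>
          ((\<lambda>y. ln (\<Psi> y)) has_real_derivative log_deriv_on a b \<Psi> x) (at x within {a..b})"
proof -
  have diff: "\<Psi> differentiable_on {a..b}" and cont': "continuous_on {a..b} (deriv_on a b \<Psi>)"
    using assms by (auto simp: C1_on_def)
  show cont: "continuous_on {a..b} \<Psi>" by (rule differentiable_imp_continuous_on[OF diff])
  have der: "(\<Psi> has_real_derivative deriv_on a b \<Psi> x) (at x within {a..b})" if "x \<in> {a..b}" for x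
    using diff that unfolding deriv_on_def differentiable_on_def
    by (auto simp: vector_derivative_works has_real_derivative_iff_has_vector_derivative)
  show "continuous_on {a..b} (log_deriv_on a b \<Psi>)"
    unfolding log_deriv_on_def[abs_def] using pos by (intro continuous_on_divide cont cont') force
  show "0 < log_deriv_on a b \<Psi> x" if x: "x \<in> {a..b}" for x
    using deriv_on_nonneg[OF assms(1) x assms(3) der[OF x]] nz[OF x] pos[OF x]
    by (simp add: log_deriv_on_def)
  show "((\<lambda>y. ln (\<Psi> y)) has_real_derivative log_deriv_on a b \<Psi> x) (at x within {a..b})"
    if x: "x \<in> {a..b}" for x
    using der[OF x] pos[OF x] unfolding log_deriv_on_def
    by (auto intro!: derivative_eq_intros)
qed

text \<open>
  By the mean value theorem \<open>ln \<circ> \<Psi>\<close> distorts distances by bounded factors only. This spares the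
  substitution \<open>u = ln (\<Psi> x)\<close>: the logarithmic kernel can be compared with \<open>\<bar>x - t\<bar> powr (\<mu> - 1)\<close>
  in the original variable.
\<close>
lemma ln_ratio_bounds:
  assumes der: "\<And>x. x \<in> {a..b} \<Longrightarrow> ((\<lambda>y. ln (\<Psi> y)) has_real_derivative w x) (at x within {a..b})"
    and pos: "\<And>x. x \<in> {a..b} \<Longrightarrow> 0 < \<Psi> x"
    and w: "\<And>x. x \<in> {a..b} \<Longrightarrow> m \<le> w x" "\<And>x. x \<in> {a..b} \<Longrightarrow> w x \<le> L"
    and xt: "a \<le> t" "t < x" "x \<le> b"
  shows "m * (x - t) \<le> ln (\<Psi> x / \<Psi> t)" "ln (\<Psi> x / \<Psi> t) \<le> L * (x - t)"
proof -
  have "\<exists>\<xi>\<in>{t<..<x}. ln (\<Psi> x) - ln (\<Psi> t) = w \<xi> * (x - t)"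
  proof (rule mvt_simple[OF xt(2)])
    fix y assume "t \<le> y" "y \<le> x"
    then show "((\<lambda>y. ln (\<Psi> y)) has_derivative (\<lambda>h. w y * h)) (at y within {t..x})"
      using der[of y] xt unfolding has_field_derivative_def
      by (auto elim!: has_derivative_subset)
  qed
  then obtain \<xi> where "\<xi> \<in> {t<..<x}" "ln (\<Psi> x / \<Psi> t) = w \<xi> * (x - t)"
    using pos[of x] pos[of t] xt by (auto simp: ln_div)
  then show "m * (x - t) \<le> ln (\<Psi> x / \<Psi> t)" "ln (\<Psi> x / \<Psi> t) \<le> L * (x - t)"
    using w[of \<xi>] xt by (auto intro!: mult_right_mono)
qed

text \<open>
  Adding the two constants covers both signs of the exponent.
\<close>
lemma powr_between:
  fixes y m L d e :: real
  assumes "0 < m" "m \<le> L" "0 < d" "m * d \<le> y" "y \<le> L * d"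
  shows "y powr e \<le> (m powr e + L powr e) * d powr e"
proof (cases "0 \<le> e")
  case True
  have "y powr e \<le> (L * d) powr e"
    using assms True mult_pos_pos[of m d] by (intro powr_mono2) linarith+
  also have "\<dots> \<le> (m powr e + L powr e) * d powr e"
    using assms by (simp add: powr_mult mult_right_mono)
  finally show ?thesis .
next
  case False
  have "y powr e \<le> (m * d) powr e"
    using assms False by (intro powr_mono2') auto
  also have "\<dots> \<le> (m powr e + L powr e) * d powr e"
    using assms by (simp add: powr_mult mult_right_mono)
  finally show ?thesis .
qed

lemma
  fixes h :: "real \<Rightarrow> complex"
  assumes "{c..d} \<subseteq> {a..b}"
  shows integrable_lebesgue_on_subinterval:
      "integrable (lebesgue_on {c..d}) h \<longleftrightarrow> integrable (lebesgue_on {a..b}) (\<lambda>t. indicator {c..d} t *\<^sub>R h t)"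
    and integral_lebesgue_on_subinterval:
      "(LINT t|lebesgue_on {c..d}. h t) = (LINT t|lebesgue_on {a..b}. indicator {c..d} t *\<^sub>R h t)"
proof -
  have "lebesgue_on {c..d} = restrict_space (lebesgue_on {a..b}) {c..d}"
    using assms by (subst restrict_restrict_space) (auto simp: Int_absorb1)
  moreover have "{c..d} \<inter> space (lebesgue_on {a..b}) \<in> sets (lebesgue_on {a..b})"
    by (auto simp: sets_restrict_space)
  ultimately show "integrable (lebesgue_on {c..d}) h \<longleftrightarrow> integrable (lebesgue_on {a..b}) (\<lambda>t. indicator {c..d} t *\<^sub>R h t)"
    and "(LINT t|lebesgue_on {c..d}. h t) = (LINT t|lebesgue_on {a..b}. indicator {c..d} t *\<^sub>R h t)"
    by (simp_all add: integrable_restrict_space integral_restrict_space)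
qed

text \<open>
  Both weights \<open>\<Psi>'/\<Psi>\<close> and the restriction to the triangle \<open>t \<le> x\<close> are included, so that the two
  sides of the integration by parts formula are the two iterated integrals of one function on the square.
\<close>
definition hadamard_kernel ::
  "real \<Rightarrow> real \<Rightarrow> (real \<Rightarrow> real) \<Rightarrow> real \<Rightarrow> real \<Rightarrow> real \<times> real \<Rightarrow> real" where
  "hadamard_kernel a b \<Psi> \<mu> s z =
     (if snd z \<le> fst z
      then log_deriv_on a b \<Psi> (fst z) * log_deriv_on a b \<Psi> (snd z)
           * ((\<Psi> (snd z) / \<Psi> (fst z)) powr s * ln (\<Psi> (fst z) / \<Psi> (snd z)) powr (\<mu> - 1))
      else 0)"

lemma hadamard_kernel_measurable:
  assumes "continuous_on {a..b} \<Psi>" "continuous_on {a..b} (log_deriv_on a b \<Psi>)"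
  shows "hadamard_kernel a b \<Psi> \<mu> s \<in> borel_measurable (lebesgue_on {a..b} \<Otimes>\<^sub>M lebesgue_on {a..b})"
proof -
  let ?M = "lebesgue_on {a..b}"
  have [measurable]: "\<Psi> \<in> borel_measurable ?M" "log_deriv_on a b \<Psi> \<in> borel_measurable ?M"
    by (auto intro!: continuous_imp_measurable_on_sets_lebesgue assms)
  have [measurable]: "(\<lambda>z. snd z \<le> fst z) \<in> measurable (?M \<Otimes>\<^sub>M ?M) (count_space UNIV)"
    by measurable
  show ?thesis
    unfolding hadamard_kernel_def[abs_def] by measurable
qed

lemma hadamard_kernel_bound:
  assumes "a < b"
    and cont: "continuous_on {a..b} \<Psi>" "continuous_on {a..b} (log_deriv_on a b \<Psi>)"
    and pos: "\<And>x. x \<in> {a..b} \<Longrightarrow> 0 < \<Psi> x" and wpos: "\<And>x. x \<in> {a..b} \<Longrightarrow> 0 < log_deriv_on a b \<Psi> x"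
    and der: "\<And>x. x \<in> {a..b} \<Longrightarrow>
          ((\<lambda>y. ln (\<Psi> y)) has_real_derivative log_deriv_on a b \<Psi> x) (at x within {a..b})"
  obtains C where "0 \<le> C"
    "\<And>x t. x \<in> {a..b} \<Longrightarrow> t \<in> {a..b} \<Longrightarrow>
       \<bar>hadamard_kernel a b \<Psi> \<mu> s (x, t)\<bar> \<le> C * \<bar>x - t\<bar> powr (\<mu> - 1)"
proof -
  let ?w = "log_deriv_on a b \<Psi>"
  obtain m L where mL: "0 < m" "m \<le> L"
    and w: "\<And>x. x \<in> {a..b} \<Longrightarrow> m \<le> ?w x" "\<And>x. x \<in> {a..b} \<Longrightarrow> ?w x \<le> L"
    using continuous_positive_on_interval_bounds[of a b ?w] assms by (metis less_imp_le)
  have "continuous_on {a..b} (\<lambda>x. \<Psi> x powr s)"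
    using cont pos by (intro continuous_intros) force+
  moreover have "0 < \<Psi> x powr s" if "x \<in> {a..b}" for x using pos[OF that] by simp
  ultimately obtain n N where nN: "0 < n" "n \<le> N"
    and P: "\<And>x. x \<in> {a..b} \<Longrightarrow> n \<le> \<Psi> x powr s" "\<And>x. x \<in> {a..b} \<Longrightarrow> \<Psi> x powr s \<le> N"
    using continuous_positive_on_interval_bounds[of a b "\<lambda>x. \<Psi> x powr s"] assms by (metis less_imp_le)
  let ?E = "m powr (\<mu> - 1) + L powr (\<mu> - 1)"
  let ?C = "L * L * (N / n * ?E)"
  show thesis
  proof (rule that)
    show "0 \<le> ?C" using mL nN by simp
    fix x t assume x: "x \<in> {a..b}" and t: "t \<in> {a..b}"
    \<comment> \<open>On the diagonal both sides are \<open>0\<close>, since \<open>ln 1 = 0\<close> and \<open>0 powr e = 0\<close>.\<close>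
    show "\<bar>hadamard_kernel a b \<Psi> \<mu> s (x, t)\<bar> \<le> ?C * \<bar>x - t\<bar> powr (\<mu> - 1)"
    proof (cases "t < x")
      case True
      have "\<bar>hadamard_kernel a b \<Psi> \<mu> s (x, t)\<bar>
          = ?w x * ?w t * (\<Psi> t powr s / \<Psi> x powr s * ln (\<Psi> x / \<Psi> t) powr (\<mu> - 1))"
        using True pos[OF x] pos[OF t] wpos[OF x] wpos[OF t]
        by (simp add: hadamard_kernel_def abs_mult powr_divide)
      also have "\<dots> \<le> L * L * (N / n * (?E * (x - t) powr (\<mu> - 1)))"
        using x t True mL nN P[OF x] P[OF t] w[OF x] w[OF t] wpos[OF x] wpos[OF t]
          ln_ratio_bounds[OF der pos w, of t x]
        by (intro mult_mono frac_le powr_between) auto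
      finally show ?thesis using True by (simp add: mult.assoc)
    next
      case False
      then show ?thesis using mL nN pos[OF x] by (cases "t = x") (auto simp: hadamard_kernel_def)
    qed
  qed
qed

section \<open>Fractional integration by parts\<close>

lemma ennreal_exponent_sum:
  assumes "0 \<le> \<alpha>" "0 \<le> \<beta>" "0 < \<mu>"
  shows "ennreal \<alpha> + ennreal \<beta> \<le> 1 + ennreal \<mu> \<longleftrightarrow> \<alpha> + \<beta> \<le> 1 + \<mu>"
    and "ennreal \<alpha> + ennreal \<beta> = 1 + ennreal \<mu> \<longleftrightarrow> \<alpha> + \<beta> = 1 + \<mu>"
  using assms by (simp_all flip: ennreal_1 ennreal_plus)

theorem lemma5p2:
  fixes a b \<mu> s c :: real
    and \<Psi> :: "real \<Rightarrow> real"
    and p q :: ennreal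
    and f g :: "real \<Rightarrow> complex"
  assumes "a < b"
    and "\<mu> > 0"
    and "C1_on a b \<Psi>"
    and "mono_on {a..b} \<Psi>"
    and "\<And>x. x \<in> {a..b} \<Longrightarrow> \<Psi> x > 0"
    and "\<And>x. x \<in> {a..b} \<Longrightarrow> deriv_on a b \<Psi> x \<noteq> 0"
    and "p \<ge> 1" and "q \<ge> 1"
    and "1 / p + 1 / q \<le> 1 + ennreal \<mu>"
    and "1 / p + 1 / q = 1 + ennreal \<mu> \<Longrightarrow> p \<noteq> 1 \<and> q \<noteq> 1"
    and "f \<in> X_space a b \<Psi> c p"
    and "g \<in> X_space a b \<Psi> c q"
  shows "(AE x in lebesgue_on {a..b}.
            integrable (lebesgue_on {a..x}) (hadamard_left_integrand a b \<Psi> \<mu> s g x))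
       \<and> (AE x in lebesgue_on {a..b}.
            integrable (lebesgue_on {x..b}) (hadamard_right_integrand a b \<Psi> \<mu> s f x))
       \<and> integrable (lebesgue_on {a..b})
            (\<lambda>x. complex_of_real (log_deriv_on a b \<Psi> x) * f x * hadamard_left a b \<Psi> \<mu> s g x)
       \<and> integrable (lebesgue_on {a..b})
            (\<lambda>x. complex_of_real (log_deriv_on a b \<Psi> x) * g x * hadamard_right a b \<Psi> \<mu> s f x)
       \<and> (LINT x|lebesgue_on {a..b}.
             complex_of_real (log_deriv_on a b \<Psi> x) * f x * hadamard_left a b \<Psi> \<mu> s g x)
         = (LINT x|lebesgue_on {a..b}.
             complex_of_real (log_deriv_on a b \<Psi> x) * g x * hadamard_right a b \<Psi> \<mu> s f x)"
proof -
  let ?M = "lebesgue_on {a..b}"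
  let ?w = "log_deriv_on a b \<Psi>"
  let ?k = "hadamard_kernel a b \<Psi> \<mu> s"
  let ?\<Phi> = "\<lambda>f g x t. complex_of_real (?k (x, t)) * f x * g t"
  interpret pair_sigma_finite ?M ?M by (rule pair_sigma_finite_interval)
  note props = log_deriv_on_properties[OF assms(1,3,4,5,6)]
  have wpos: "0 < ?w x" if "x \<in> {a..b}" for x using props(3) that by blast
  obtain m1 where m1: "0 < m1" "\<And>x. x \<in> {a..b} \<Longrightarrow> m1 \<le> ?w x"
    using continuous_positive_on_interval_bounds[of a b ?w] assms(1) props by (metis less_imp_le)
  have "continuous_on {a..b} (\<lambda>x. \<Psi> x powr c)"
    using props(1) assms(5) by (intro continuous_intros) force+
  moreover have "0 < \<Psi> x powr c" if "x \<in> {a..b}" for x using assms(5)[OF that] by simp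
  ultimately obtain m2 where m2: "0 < m2" "\<And>x. x \<in> {a..b} \<Longrightarrow> m2 \<le> \<Psi> x powr c"
    using continuous_positive_on_interval_bounds[of a b "\<lambda>x. \<Psi> x powr c"] assms(1) by (metis less_imp_le)
  define m where "m = min m1 m2"
  have m: "0 < m" "\<And>x. x \<in> {a..b} \<Longrightarrow> m \<le> \<Psi> x powr c" "\<And>x. x \<in> {a..b} \<Longrightarrow> m \<le> ?w x"
    using m1 m2 by (auto simp: m_def min_le_iff_disj)
  have f_meas: "f \<in> borel_measurable ?M" and g_meas: "g \<in> borel_measurable ?M"
    using assms by (auto simp: X_space_def)
  obtain F A \<alpha> where F: "F \<in> borel_measurable ?M" "\<And>x. 1 \<le> F x" "(\<integral>\<^sup>+ x. ennreal (F x) \<partial>?M) < \<infinity>"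
    "AE x in ?M. norm (f x) \<le> A * F x powr \<alpha>"
    and \<alpha>: "0 \<le> A" "0 \<le> \<alpha>" "\<alpha> \<le> 1" "1 / p = ennreal \<alpha>" "\<alpha> = 1 \<longrightarrow> p = 1"
    by (rule X_space_majorant[OF assms(11,7) m]) (assumption | rule that)+
  obtain G B \<beta> where G: "G \<in> borel_measurable ?M" "\<And>x. 1 \<le> G x" "(\<integral>\<^sup>+ x. ennreal (G x) \<partial>?M) < \<infinity>"
    "AE x in ?M. norm (g x) \<le> B * G x powr \<beta>"
    and \<beta>: "0 \<le> B" "0 \<le> \<beta>" "\<beta> \<le> 1" "1 / q = ennreal \<beta>" "\<beta> = 1 \<longrightarrow> q = 1"
    by (rule X_space_majorant[OF assms(12,8) m]) (assumption | rule that)+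
  have one: "(\<lambda>_. 1) \<in> borel_measurable ?M" "\<And>x::real. (1::real) \<le> 1" "(\<integral>\<^sup>+ x. ennreal 1 \<partial>?M) < \<infinity>"
      "AE x in ?M. norm (1::complex) \<le> 1 * 1 powr 0"
    using emeasure_lborel_Icc[of a b] assms(1) by (auto simp: emeasure_restrict_space)
  have exps: "\<alpha> + \<beta> + (1 - \<mu>) \<le> 2" "\<alpha> + \<beta> + (1 - \<mu>) = 2 \<Longrightarrow> \<alpha> < 1 \<and> \<beta> < 1"
    using assms(9,10) \<alpha> \<beta> ennreal_exponent_sum[OF \<alpha>(2) \<beta>(2) assms(2)] by auto
  obtain C where C: "0 \<le> C" "\<And>x t. x \<in> {a..b} \<Longrightarrow> t \<in> {a..b} \<Longrightarrow> \<bar>?k (x, t)\<bar> \<le> C * \<bar>x - t\<bar> powr (- (1 - \<mu>))"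
    using hadamard_kernel_bound[OF assms(1) props(1,2) assms(5) props(3,4), of \<mu> s] by auto
  note k_meas = hadamard_kernel_measurable[OF props(1,2), of \<mu> s]
  have int: "integrable (?M \<Otimes>\<^sub>M ?M) (case_prod (?\<Phi> f g))"
    by (rule weakly_singular_product_integrable[OF f_meas g_meas k_meas F(1,2) G(1,2) F(3) G(3) F(4) G(4) C(2)])
       (use \<alpha> \<beta> exps C assms(2) in auto)
  \<comment> \<open>With \<open>f\<close> replaced by \<open>1\<close> (majorant \<open>1\<close>, exponent \<open>0\<close>), almost every section is integrable,
     including those at zeros of \<open>f\<close>, about which the integrability of the full product says nothing.\<close>
  have int_g: "integrable (?M \<Otimes>\<^sub>M ?M) (case_prod (?\<Phi> (\<lambda>_. 1) g))"
    by (rule weakly_singular_product_integrable[OF _ g_meas k_meas one(1,2) G(1,2) one(3) G(3) one(4) G(4) C(2)])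
       (use \<beta> C assms(2) in auto)
  have int_f: "integrable (?M \<Otimes>\<^sub>M ?M) (case_prod (?\<Phi> f (\<lambda>_. 1)))"
    by (rule weakly_singular_product_integrable[OF f_meas _ k_meas F(1,2) one(1,2) F(3) one(3) F(4) one(4) C(2)])
       (use \<alpha> C assms(2) in auto)
  have left: "?\<Phi> u v x t = complex_of_real (?w x) * u x
      * (indicator {a..x} t *\<^sub>R hadamard_left_integrand a b \<Psi> \<mu> s v x t)"
    if "t \<in> {a..b}" for u v x t
    using that by (auto simp: hadamard_kernel_def hadamard_left_integrand_def indicator_def)
  have right: "?\<Phi> u v x t = complex_of_real (?w t) * v t
      * (indicator {t..b} x *\<^sub>R hadamard_right_integrand a b \<Psi> \<mu> s u t x)"
    if "x \<in> {a..b}" for u v x t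
    using that by (auto simp: hadamard_kernel_def hadamard_right_integrand_def indicator_def)
  have AE_left: "AE x in ?M. integrable (lebesgue_on {a..x}) (hadamard_left_integrand a b \<Psi> \<mu> s g x)"
    using AE_integrable_fst[OF int_g] AE_space
  proof eventually_elim
    case (elim x)
    then have x: "x \<in> {a..b}" by simp
    have "integrable ?M (\<lambda>t. complex_of_real (1 / ?w x) * ?\<Phi> (\<lambda>_. 1) g x t)"
      by (intro integrable_mult_right elim(1))
    then have "integrable ?M (\<lambda>t. indicator {a..x} t *\<^sub>R hadamard_left_integrand a b \<Psi> \<mu> s g x t)"
    proof (rule Bochner_Integration.integrable_cong[THEN iffD1, rotated -1])
      fix t assume "t \<in> space ?M"
      then have t: "t \<in> {a..b}" by simp
      show "complex_of_real (1 / ?w x) * ?\<Phi> (\<lambda>_. 1) g x t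
          = indicator {a..x} t *\<^sub>R hadamard_left_integrand a b \<Psi> \<mu> s g x t"
        using wpos[OF x] by (simp only: left[OF t, of x "\<lambda>_. 1" g]) simp
    qed simp
    then show ?case using x by (subst integrable_lebesgue_on_subinterval[of _ _ a b]) auto
  qed
  have AE_right: "AE x in ?M. integrable (lebesgue_on {x..b}) (hadamard_right_integrand a b \<Psi> \<mu> s f x)"
    using AE_integrable_snd[OF int_f] AE_space
  proof eventually_elim
    case (elim t)
    then have t: "t \<in> {a..b}" by simp
    have "integrable ?M (\<lambda>x. complex_of_real (1 / ?w t) * ?\<Phi> f (\<lambda>_. 1) x t)"
      by (intro integrable_mult_right elim(1))
    then have "integrable ?M (\<lambda>x. indicator {t..b} x *\<^sub>R hadamard_right_integrand a b \<Psi> \<mu> s f t x)"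
    proof (rule Bochner_Integration.integrable_cong[THEN iffD1, rotated -1])
      fix x assume "x \<in> space ?M"
      then have x: "x \<in> {a..b}" by simp
      show "complex_of_real (1 / ?w t) * ?\<Phi> f (\<lambda>_. 1) x t
          = indicator {t..b} x *\<^sub>R hadamard_right_integrand a b \<Psi> \<mu> s f t x"
        using wpos[OF t] by (simp only: right[OF x, of t f "\<lambda>_. 1"]) simp
    qed simp
    then show ?case using t by (subst integrable_lebesgue_on_subinterval[of _ _ a b]) auto
  qed
  let ?c = "complex_of_real (1 / Gamma \<mu>)"
  have left_section: "?c * (LINT t|?M. ?\<Phi> f g x t)
      = complex_of_real (?w x) * f x * hadamard_left a b \<Psi> \<mu> s g x" if "x \<in> space ?M" for x
  proof -
    have sub: "{a..x} \<subseteq> {a..b}" using that by auto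
    have "(LINT t|?M. ?\<Phi> f g x t) = (LINT t|?M. complex_of_real (?w x) * f x
      * (indicator {a..x} t *\<^sub>R hadamard_left_integrand a b \<Psi> \<mu> s g x t))"
      by (rule Bochner_Integration.integral_cong) (auto simp: left)
    also have "\<dots> = complex_of_real (?w x) * f x
      * (LINT t|lebesgue_on {a..x}. hadamard_left_integrand a b \<Psi> \<mu> s g x t)"
      by (simp only: integral_mult_right_zero integral_lebesgue_on_subinterval[OF sub])
    finally show ?thesis by (simp add: hadamard_left_def)
  qed
  have right_section: "?c * (LINT x|?M. ?\<Phi> f g x t)
      = complex_of_real (?w t) * g t * hadamard_right a b \<Psi> \<mu> s f t" if "t \<in> space ?M" for t
  proof -
    have sub: "{t..b} \<subseteq> {a..b}" using that by auto
    have "(LINT x|?M. ?\<Phi> f g x t) = (LINT x|?M. complex_of_real (?w t) * g t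
      * (indicator {t..b} x *\<^sub>R hadamard_right_integrand a b \<Psi> \<mu> s f t x))"
      by (rule Bochner_Integration.integral_cong) (auto simp: right)
    also have "\<dots> = complex_of_real (?w t) * g t
      * (LINT x|lebesgue_on {t..b}. hadamard_right_integrand a b \<Psi> \<mu> s f t x)"
      by (simp only: integral_mult_right_zero integral_lebesgue_on_subinterval[OF sub])
    finally show ?thesis by (simp add: hadamard_right_def)
  qed
  have "integrable ?M (\<lambda>x. ?c * (LINT t|?M. ?\<Phi> f g x t))"
    by (intro integrable_mult_right integrable_fst int)
  then have int_left: "integrable ?M (\<lambda>x. complex_of_real (?w x) * f x * hadamard_left a b \<Psi> \<mu> s g x)"
    by (rule Bochner_Integration.integrable_cong[THEN iffD1, rotated -1]) (simp_all only: left_section)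
  have "integrable ?M (\<lambda>t. ?c * (LINT x|?M. ?\<Phi> f g x t))"
    by (intro integrable_mult_right integrable_snd int)
  then have int_right: "integrable ?M (\<lambda>t. complex_of_real (?w t) * g t * hadamard_right a b \<Psi> \<mu> s f t)"
    by (rule Bochner_Integration.integrable_cong[THEN iffD1, rotated -1]) (simp_all only: right_section)
  have "(LINT x|?M. complex_of_real (?w x) * f x * hadamard_left a b \<Psi> \<mu> s g x)
      = (LINT x|?M. ?c * (LINT t|?M. ?\<Phi> f g x t))"
    by (rule Bochner_Integration.integral_cong) (simp_all only: left_section)
  also have "\<dots> = (LINT t|?M. ?c * (LINT x|?M. ?\<Phi> f g x t))"
    by (simp only: integral_mult_right_zero Fubini_integral[OF int])
  also have "\<dots> = (LINT t|?M. complex_of_real (?w t) * g t * hadamard_right a b \<Psi> \<mu> s f t)"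
    by (rule Bochner_Integration.integral_cong) (simp_all only: right_section)
  finally show ?thesis
    using AE_left AE_right int_left int_right by blast
qed

end
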